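(* Let $G$ be a connected simple graph on $n$ vertices with diameter $\operatorname{diam}(G)$ and maximum degree $\Delta$, and let $\alpha \in [0,1]$. If $G$ is non-bipartite, then $$\lambda_n(A_\alpha(G)) \ge -\Delta + \frac{1+\alpha}{n(\operatorname{diam}(G) + 1)}.$$
   Context: For a simple graph $G$ with adjacency matrix $A(G)$ and diagonal degree matrix $D(G)$, and $\alpha\in[0,1]$, define $A_\alpha(G) = \alpha D(G) + (1-\alpha)A(G)$, with eigenvalues ordered $\lambda_1(A_\alpha(G)) \ge \dots \ge \lambda_n(A_\alpha(G))$. The diameter of a connected graph is the maximum distance between two of its vertices. *)

theory Defs
  imports "Graph_Theory.Graph_Theory" "Jordan_Normal_Form.Char_Poly"
begin

text \<open>
  Simple graphs are the finite symmetric loop-free digraphs without parallel arcs of locale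
  \<open>graph\<close>: an edge \<open>uv\<close> is the pair of arcs \<open>u \<rightarrow> v\<close> and \<open>v \<rightarrow> u\<close>, so the degree of a vertex
  is its \<^const>\<open>out_degree\<close>.
\<close>

definition max_degree :: "('a, 'b) pre_digraph \<Rightarrow> nat" where
  "max_degree G = Max (out_degree G ` verts G)"

definition bipartite :: "('a, 'b) pre_digraph \<Rightarrow> bool" where
  "bipartite G \<longleftrightarrow> (\<exists>X Y. X \<union> Y = verts G \<and> X \<inter> Y = {} \<and>
     (\<forall>u v. u \<rightarrow>\<^bsub>G\<^esub> v \<longrightarrow> u \<in> X \<and> v \<in> Y \<or> u \<in> Y \<and> v \<in> X))"

text \<open>The value of \<open>distance G u v\<close> is meaningful only if \<open>v\<close> is reachable from \<open>u\<close>.\<close>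

definition distance :: "('a, 'b) pre_digraph \<Rightarrow> 'a \<Rightarrow> 'a \<Rightarrow> nat" where
  "distance G u v = (LEAST k. \<exists>p. pre_digraph.awalk G u p v \<and> length p = k)"

definition diameter :: "('a, 'b) pre_digraph \<Rightarrow> nat" where
  "diameter G = Max {distance G u v | u v. u \<in> verts G \<and> v \<in> verts G}"

lemma (in wf_digraph) distance_eq_\<mu>:
  assumes "u \<rightarrow>\<^sup>* v"
  shows "\<mu> (\<lambda>_. 1) u v = ereal (real (distance G u v))"
proof -
  let ?P = "\<lambda>k. \<exists>p. awalk u p v \<and> length p = k"
  have cost: "awalk_cost (\<lambda>_. 1) p = real (length p)" for p :: "'b list"
    by (induction p) auto
  from assms obtain q where "awalk u q v"
    by (auto simp: reachable_awalk)
  then have "?P (length q)"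
    by blast
  then have "?P (distance G u v)"
    unfolding distance_def by (rule LeastI)
  then obtain p where p: "awalk u p v" "length p = distance G u v"
    by blast
  have le: "distance G u v \<le> length r" if "awalk u r v" for r
    unfolding distance_def using that by (intro Least_le) blast
  show ?thesis
    unfolding \<mu>_def
  proof (rule antisym)
    show "(INF p\<in>{p. awalk u p v}. ereal (awalk_cost (\<lambda>_. 1) p)) \<le> ereal (real (distance G u v))"
      using p by (intro INF_lower2[of p]) (auto simp: cost)
    show "ereal (real (distance G u v)) \<le> (INF p\<in>{p. awalk u p v}. ereal (awalk_cost (\<lambda>_. 1) p))"
      using le by (intro INF_greatest) (auto simp: cost)
  qed
qed

text \<open>
  The matrices of \<open>G\<close> are taken with respect to an enumeration \<open>vs\<close> of the vertices without
  repetitions; their spectrum does not depend on it.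
\<close>

definition adjacency_matrix :: "('a, 'b) pre_digraph \<Rightarrow> 'a list \<Rightarrow> real mat" where
  "adjacency_matrix G vs = mat (length vs) (length vs)
     (\<lambda>(i, j). if vs ! i \<rightarrow>\<^bsub>G\<^esub> vs ! j then 1 else 0)"

definition degree_matrix :: "('a, 'b) pre_digraph \<Rightarrow> 'a list \<Rightarrow> real mat" where
  "degree_matrix G vs = mat (length vs) (length vs)
     (\<lambda>(i, j). if i = j then real (out_degree G (vs ! i)) else 0)"

definition A_alpha :: "real \<Rightarrow> ('a, 'b) pre_digraph \<Rightarrow> 'a list \<Rightarrow> real mat" where
  "A_alpha \<alpha> G vs = \<alpha> \<cdot>\<^sub>m degree_matrix G vs + (1 - \<alpha>) \<cdot>\<^sub>m adjacency_matrix G vs"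

text \<open>
  The eigenvalues with multiplicity in non-increasing order, \<open>\<lambda>\<^sub>k\<close> being counted from \<open>k = 1\<close>.
  Only real roots of the characteristic polynomial are listed; for a symmetric matrix
  of dimension \<open>n\<close> these are all \<open>n\<close> eigenvalues.
\<close>

definition eigenvalue_list :: "real mat \<Rightarrow> real list" where
  "eigenvalue_list A = rev (sorted_list_of_multiset (proots (char_poly A)))"

definition kth_eigenvalue :: "nat \<Rightarrow> real mat \<Rightarrow> real" where
  "kth_eigenvalue k A = eigenvalue_list A ! (k - 1)"

end

theory Submission
  imports Defs
begin

text \<open>
  The matrix \<open>A\<^sub>\<alpha>\<close> is a convex combination of \<open>D\<close>, whose quadratic form is non-negative, and
  \<open>A\<close>, so the crux is the case \<open>\<alpha> = 0\<close>. There \<open>x\<^sup>T (D + A) x\<close> is the sum of \<open>(x\<^sub>u + x\<^sub>v)\<^sup>2\<close> over the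
  edges \<open>uv\<close>. Given a vertex \<open>w\<close>, non-bipartiteness yields an edge \<open>uv\<close> whose ends have the same
  distance \<open>d\<close> from \<open>w\<close>. Either a geodesic from \<open>w\<close> to \<open>v\<close> or a geodesic from \<open>w\<close> to \<open>u\<close> followed
  by \<open>uv\<close> is a path of length \<open>k \<le> diam G + 1\<close> ending in a vertex whose sign differs from the one
  obtained by alternating along the path from \<open>w\<close>. The alternating sum telescopes, and
  Cauchy-Schwarz gives an energy of at least \<open>x\<^sub>w\<^sup>2 / k\<close> on that path.
\<close>

section \<open>Cauchy-Schwarz and telescoping for finite sums\<close>

lemma sum_lessThan_squared_le:
  fixes f :: "nat \<Rightarrow> real"
  shows "(\<Sum>j<k. f j)\<^sup>2 \<le> real k * (\<Sum>j<k. (f j)\<^sup>2)"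
proof -
  \<comment> \<open>Lagrange's identity: the defect in Cauchy-Schwarz against the all-ones vector is
    half of this double sum.\<close>
  have "0 \<le> (\<Sum>i<k. \<Sum>j<k. (f i - f j)\<^sup>2)"
    by (intro sum_nonneg) auto
  also have "\<dots> = 2 * real k * (\<Sum>j<k. (f j)\<^sup>2) - 2 * (\<Sum>j<k. f j)\<^sup>2"
    by (simp add: power2_diff sum.distrib sum_subtractf power2_eq_square sum_product
        sum_distrib_left mult.assoc algebra_simps)
  finally show ?thesis by simp
qed

lemma alternating_telescope:
  fixes f :: "nat \<Rightarrow> real"
  shows "(\<Sum>j<k. (-1) ^ j * (f j + f (Suc j))) = f 0 - (-1) ^ k * f k"
  by (induction k) (auto simp: algebra_simps)

section \<open>Spectra of real symmetric matrices\<close>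

lemma eigenvalue_of_real_symmetric_real:
  fixes A :: "real mat"
  assumes A: "A \<in> carrier_mat n n"
    and sym: "\<And>i j. i < n \<Longrightarrow> j < n \<Longrightarrow> A $$ (i, j) = A $$ (j, i)"
    and ev: "eigenvalue (map_mat complex_of_real A) \<mu>"
  shows "\<mu> \<in> \<real>"
proof -
  obtain z where z: "z \<in> carrier_vec n" "z \<noteq> 0\<^sub>v n"
    and eq: "map_mat complex_of_real A *\<^sub>v z = \<mu> \<cdot>\<^sub>v z"
    using ev A unfolding eigenvalue_def eigenvector_def by auto
  have row: "(\<Sum>j<n. complex_of_real (A $$ (i, j)) * z $ j) = \<mu> * z $ i" if "i < n" for i
  proof -
    have "(map_mat complex_of_real A *\<^sub>v z) $ i = (\<Sum>j<n. complex_of_real (A $$ (i, j)) * z $ j)"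
      using that A z by (auto simp: mult_mat_vec_def scalar_prod_def lessThan_atLeast0 intro!: sum.cong)
    then show ?thesis using eq that z by simp
  qed
  \<comment> \<open>\<open>F\<close> is the Hermitian form of \<open>A\<close> at \<open>z\<close>
    and \<open>N\<close> the squared norm of \<open>z\<close>. Symmetry makes \<open>F\<close> real,
    \<open>N\<close> is real and nonzero, and \<open>F = \<mu> * N\<close>, so \<open>\<mu>\<close>
    is real.\<close>
  define N where "N = (\<Sum>i<n. cnj (z $ i) * z $ i)"
  define F where "F = (\<Sum>i<n. \<Sum>j<n. complex_of_real (A $$ (i, j)) * (cnj (z $ i) * z $ j))"
  have F: "F = \<mu> * N"
  proof -
    have "F = (\<Sum>i<n. cnj (z $ i) * (\<Sum>j<n. complex_of_real (A $$ (i, j)) * z $ j))"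
      by (simp add: F_def sum_distrib_left mult_ac)
    also have "\<dots> = (\<Sum>i<n. cnj (z $ i) * (\<mu> * z $ i))"
      by (intro sum.cong) (auto simp: row)
    finally show ?thesis by (simp add: N_def sum_distrib_left mult_ac)
  qed
  have cF: "cnj F = F"
  proof -
    have "cnj F = (\<Sum>i<n. \<Sum>j<n. complex_of_real (A $$ (i, j)) * (z $ i * cnj (z $ j)))"
      by (simp add: F_def)
    also have "\<dots> = (\<Sum>j<n. \<Sum>i<n. complex_of_real (A $$ (i, j)) * (z $ i * cnj (z $ j)))"
      by (rule sum.swap)
    also have "\<dots> = F"
      unfolding F_def by (intro sum.cong refl) (auto simp: sym mult_ac)
    finally show ?thesis .
  qed
  have Nr: "N = complex_of_real (\<Sum>i<n. (cmod (z $ i))\<^sup>2)"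
    unfolding N_def of_real_sum by (intro sum.cong refl) (metis complex_norm_square mult.commute)
  obtain i where i: "i < n" "z $ i \<noteq> 0"
    using z by (metis carrier_vecD eq_vecI index_zero_vec)
  have "(\<Sum>i<n. (cmod (z $ i))\<^sup>2) > 0"
    by (rule sum_pos2[of _ i]) (use i in auto)
  then have "N \<noteq> 0" by (simp add: Nr del: of_real_sum)
  moreover have "cnj \<mu> * N = \<mu> * N"
    using F cF by (simp add: Nr)
  ultimately show ?thesis by (simp add: Reals_cnj_iff)
qed

text \<open>The characteristic polynomial splits over the complex numbers. Its roots are real by the
  previous lemma, so the factorization descends to the reals, where \<open>proots\<close> counts
  roots with multiplicity.\<close>

lemma size_proots_char_poly_symmetric:
  fixes A :: "real mat"
  assumes A: "A \<in> carrier_mat n n"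
    and sym: "\<And>i j. i < n \<Longrightarrow> j < n \<Longrightarrow> A $$ (i, j) = A $$ (j, i)"
  shows "size (proots (char_poly A)) = n"
proof -
  let ?C = "map_mat complex_of_real A"
  have C: "?C \<in> carrier_mat n n" using A by simp
  obtain as where as: "char_poly ?C = (\<Prod>a\<leftarrow>as. [:- a, 1:])" and len: "length as = n"
    using char_poly_factorized[OF C] by auto
  have real: "a \<in> \<real>" if "a \<in> set as" for a
  proof (rule eigenvalue_of_real_symmetric_real[OF A sym])
    have "poly (char_poly ?C) a = 0"
      using that unfolding as by (simp add: poly_prod_list prod_list_zero_iff image_iff)
    then show "eigenvalue ?C a"
      using eigenvalue_root_char_poly[OF C] by simp
  qed
  define bs where "bs = map Re as"
  have as_bs: "as = map complex_of_real bs"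
    unfolding bs_def using real by (induction as) auto
  have "map_poly complex_of_real (char_poly A) = char_poly ?C"
    by (rule of_real_hom.char_poly_hom[OF A, symmetric])
  also have "\<dots> = map_poly complex_of_real (\<Prod>b\<leftarrow>bs. [:- b, 1:])"
    unfolding as as_bs
    by (induction bs)
      (auto simp: poly_eq_iff coeff_map_poly coeff_pCons map_poly_pCons split: nat.splits)
  finally have "char_poly A = (\<Prod>b\<leftarrow>bs. [:- b, 1:])"
    by (simp add: poly_eq_iff coeff_map_poly)
  moreover have "size (proots (\<Prod>b\<leftarrow>bs. [:- b, 1:])) = length bs" for bs :: "real list"
  proof (induction bs)
    case (Cons b bs)
    have "(\<Prod>b\<leftarrow>bs. [:- b, 1:]) \<noteq> 0" by (auto simp: prod_list_zero_iff)
    then show ?case using Cons by (simp add: proots_mult del: mult_pCons_left)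
  qed simp
  moreover have "length bs = n" using len by (simp add: bs_def)
  ultimately show ?thesis by simp
qed

text \<open>The lookup in \<open>eigenvalue_list\<close> is meaningful only within its length. The
  root count makes that length \<open>n\<close>, so the entry really is a root of the characteristic
  polynomial.\<close>

lemma kth_eigenvalue_symmetric:
  fixes A :: "real mat"
  assumes A: "A \<in> carrier_mat n n"
    and sym: "\<And>i j. i < n \<Longrightarrow> j < n \<Longrightarrow> A $$ (i, j) = A $$ (j, i)"
    and "1 \<le> k" "k \<le> n"
  shows "eigenvalue A (kth_eigenvalue k A)"
proof -
  have len: "length (eigenvalue_list A) = n"
    using size_proots_char_poly_symmetric[OF A sym]
    by (metis eigenvalue_list_def length_rev mset_sorted_list_of_multiset size_mset)
  have nz: "char_poly A \<noteq> 0"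
    using degree_monic_char_poly[OF A] by auto
  have "kth_eigenvalue k A \<in> set (eigenvalue_list A)"
    unfolding kth_eigenvalue_def by (rule nth_mem) (use len assms in simp)
  then have "kth_eigenvalue k A \<in># proots (char_poly A)"
    by (simp add: eigenvalue_list_def)
  then show ?thesis
    using nz eigenvalue_root_char_poly[OF A] by simp
qed

section \<open>Distances and geodesics\<close>

context wf_digraph
begin

lemma distance_le_length:
  assumes "awalk u p v"
  shows "distance G u v \<le> length p"
  unfolding distance_def using assms by (intro Least_le) blast

lemma distance_awalkE:
  assumes "u \<rightarrow>\<^sup>* v"
  obtains p where "awalk u p v" "length p = distance G u v"
proof -
  let ?P = "\<lambda>k. \<exists>p. awalk u p v \<and> length p = k"
  from assms obtain q where "awalk u q v" by (auto simp: reachable_awalk)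
  then have "?P (length q)" by blast
  then have "?P (distance G u v)" unfolding distance_def by (rule LeastI)
  then show ?thesis using that by blast
qed

lemma distance_self: "u \<in> verts G \<Longrightarrow> distance G u u = 0"
  using distance_le_length[of u "[]" u] by (simp add: awalk_Nil_iff)

lemma distance_eq_0_iff:
  assumes "u \<rightarrow>\<^sup>* v"
  shows "distance G u v = 0 \<longleftrightarrow> u = v"
  using assms distance_awalkE[OF assms]
  by (metis awalk_Nil_iff distance_self length_0_conv reachable_in_verts(1))

lemma distance_adj_le:
  assumes "u \<rightarrow>\<^sup>* v" "v \<rightarrow> w"
  shows "distance G u w \<le> Suc (distance G u v)"
proof -
  obtain p where p: "awalk u p v" "length p = distance G u v"
    using distance_awalkE[OF assms(1)] .
  obtain e where "e \<in> arcs G" "tail G e = v" "head G e = w"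
    using assms(2) by auto
  then have "awalk v [e] w" by (auto simp: awalk_Cons_iff awalk_Nil_iff)
  then have "awalk u (p @ [e]) w" using p(1) by (rule awalk_appendI[rotated])
  from distance_le_length[OF this] p show ?thesis by simp
qed

text \<open>Drop the last arc of a shortest walk. The rest has length \<open>i\<close>, and its end
  cannot be nearer to \<open>u\<close>, since one arc raises the distance by at most one.\<close>

lemma distance_predecessor:
  assumes "u \<rightarrow>\<^sup>* w" "distance G u w = Suc i"
  obtains v where "u \<rightarrow>\<^sup>* v" "v \<rightarrow> w" "distance G u v = i"
proof -
  obtain p where p: "awalk u p w" "length p = Suc i"
    using distance_awalkE[OF assms(1)] assms(2) by metis
  then obtain q e where pq: "p = q @ [e]" by (cases p rule: rev_cases) auto
  let ?v = "tail G e"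
  have q: "awalk u q ?v" and e: "e \<in> arcs G" "head G e = w"
    using p(1) unfolding pq by (auto simp: awalk_Cons_iff awalk_Nil_iff)
  have r: "u \<rightarrow>\<^sup>* ?v" using q by (rule reachable_awalkI)
  have adj: "?v \<rightarrow> w" using e by (auto simp: arcs_ends_conv)
  have "distance G u ?v \<le> i" using distance_le_length[OF q] p pq by simp
  moreover have "i \<le> distance G u ?v" using distance_adj_le[OF r adj] assms(2) by simp
  ultimately show ?thesis using that r adj by auto
qed

text \<open>The path is a function of the position. That its \<open>j\<close>-th vertex lies at
  distance \<open>j\<close> later yields injectivity, and shows which vertices are off the
  path.\<close>

lemma geodesic:
  assumes "u \<rightarrow>\<^sup>* w" "distance G u w = d"
  obtains p where "p 0 = u" "p d = w" "\<And>j. j < d \<Longrightarrow> p j \<rightarrow> p (Suc j)"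
    "\<And>j. j \<le> d \<Longrightarrow> distance G u (p j) = j"
  using assms
proof (induction d arbitrary: w thesis)
  case 0
  then have "u = w" using distance_eq_0_iff by blast
  then show ?case using 0 by (intro "0.prems"(1)[of "\<lambda>_. u"]) auto
next
  case (Suc d)
  obtain v where v: "u \<rightarrow>\<^sup>* v" "v \<rightarrow> w" "distance G u v = d"
    using distance_predecessor[OF Suc.prems(2,3)] .
  obtain p where p: "p 0 = u" "p d = v" "\<And>j. j < d \<Longrightarrow> p j \<rightarrow> p (Suc j)"
    "\<And>j. j \<le> d \<Longrightarrow> distance G u (p j) = j"
    using Suc.IH[OF _ v(1,3)] by metis
  show ?case
    by (rule Suc.prems(1)[of "p(Suc d := w)"]) (use p v Suc.prems in \<open>auto simp: less_Suc_eq le_Suc_eq\<close>)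
qed

end

section \<open>Diameter and maximum degree as upper bounds\<close>

context fin_digraph
begin

lemma distance_le_diameter:
  assumes "u \<in> verts G" "v \<in> verts G"
  shows "distance G u v \<le> diameter G"
proof -
  have "finite {distance G u v | u v. u \<in> verts G \<and> v \<in> verts G}"
    by (rule finite_image_set2) auto
  then show ?thesis unfolding diameter_def using assms by (intro Max_ge) auto
qed

lemma out_degree_le_max_degree: "u \<in> verts G \<Longrightarrow> out_degree G u \<le> max_degree G"
  unfolding max_degree_def by (intro Max_ge) auto

end

section \<open>Energy of a non-bipartite graph\<close>

context graph
begin

lemma adj_commute: "u \<rightarrow> v \<longleftrightarrow> v \<rightarrow> u"
  using sym_arcs by (auto simp: symmetric_def dest: symD)

lemma out_degree_eq_card: "out_degree G u = card {v \<in> verts G. u \<rightarrow> v}"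
proof -
  have "inj_on (head G) (out_arcs G u)"
    by (rule inj_onI) (auto intro!: no_multi_arcs simp: arc_to_ends_def)
  moreover have "head G ` out_arcs G u = {v \<in> verts G. u \<rightarrow> v}"
    by (auto simp: arcs_ends_conv)
  ultimately show ?thesis unfolding out_degree_def by (metis card_image)
qed

lemma connected_reachable:
  assumes "connected G" "u \<in> verts G" "v \<in> verts G"
  shows "u \<rightarrow>\<^sup>* v"
  using assms reachable_mk_symmetric_eq by (auto simp: connected_def strongly_connected_def)

text \<open>Every edge enters in both orientations, so this is twice the quadratic form of the
  signless Laplacian \<open>D + A\<close>. Hence the factors 2 in the estimates below.\<close>

definition energy :: "('a \<Rightarrow> real) \<Rightarrow> real" where
  "energy x = (\<Sum>(u, v)\<in>arcs_ends G. (x u + x v)\<^sup>2)"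

lemma finite_arcs_ends: "finite (arcs_ends G)"
  by (simp add: arcs_ends_conv)

text \<open>Cauchy-Schwarz applied to the alternating sum along the path. Injectivity of
  \<open>p\<close> ensures that the path edges, each in both orientations, contribute
  \<open>2 * k\<close> different terms of the energy.\<close>

lemma path_energy:
  assumes inj: "inj_on p {..k}" and adj: "\<And>j. j < k \<Longrightarrow> p j \<rightarrow> p (Suc j)"
  shows "2 * (x (p 0) - (-1) ^ k * x (p k))\<^sup>2 \<le> real k * energy x"
proof -
  let ?f = "\<lambda>(u, v). (x u + x v)\<^sup>2"
  let ?P = "(\<lambda>j. (p j, p (Suc j))) ` {..<k}" and ?Q = "(\<lambda>j. (p (Suc j), p j)) ` {..<k}"
  have eq: "p i = p j \<longleftrightarrow> i = j" if "i \<le> k" "j \<le> k" for i j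
    using inj that by (auto dest: inj_onD)
  have sub: "?P \<union> ?Q \<subseteq> arcs_ends G"
    using adj adj_commute by auto
  \<comment> \<open>A common pair would require \<open>i = Suc j\<close> and
    \<open>Suc i = j\<close>.\<close>
  have disj: "?P \<inter> ?Q = {}" by (auto simp: eq)
  define S where "S = (\<Sum>j<k. (x (p j) + x (p (Suc j)))\<^sup>2)"
  have P: "sum ?f ?P = S" unfolding S_def
    by (subst sum.reindex) (auto simp: inj_on_def eq)
  have Q: "sum ?f ?Q = S" unfolding S_def
    by (subst sum.reindex) (auto simp: inj_on_def eq add.commute)
  have "2 * S = sum ?f (?P \<union> ?Q)"
    using disj P Q by (subst sum.union_disjoint) auto
  also have "\<dots> \<le> energy x"
    unfolding energy_def by (rule sum_mono2[OF finite_arcs_ends sub]) auto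
  finally have S: "2 * S \<le> energy x" .
  have "(x (p 0) - (-1) ^ k * x (p k))\<^sup>2 = (\<Sum>j<k. (-1) ^ j * (x (p j) + x (p (Suc j))))\<^sup>2"
    using alternating_telescope[of "\<lambda>j. x (p j)" k] by simp
  also have "\<dots> \<le> real k * (\<Sum>j<k. ((-1) ^ j * (x (p j) + x (p (Suc j))))\<^sup>2)"
    by (rule sum_lessThan_squared_le)
  also have "\<dots> = real k * S"
    by (simp add: S_def power_mult_distrib flip: power_mult)
  finally have "2 * (x (p 0) - (-1) ^ k * x (p k))\<^sup>2 \<le> real k * (2 * S)" by simp
  also have "\<dots> \<le> real k * energy x" using S by (intro mult_left_mono) auto
  finally show ?thesis .
qed

text \<open>Distances from \<open>w\<close> differ by at most one along an edge. If they always
  differed, their parity would be a bipartition.\<close>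

lemma nonbipartite_level_edge:
  assumes con: "connected G" and nb: "\<not> bipartite G" and w: "w \<in> verts G"
  obtains u v where "u \<rightarrow> v" "distance G w u = distance G w v"
proof -
  have False if no: "\<And>u v. u \<rightarrow> v \<Longrightarrow> distance G w u \<noteq> distance G w v"
  proof -
    let ?X = "{u \<in> verts G. even (distance G w u)}" and ?Y = "{u \<in> verts G. odd (distance G w u)}"
    have "u \<in> ?X \<and> v \<in> ?Y \<or> u \<in> ?Y \<and> v \<in> ?X" if uv: "u \<rightarrow> v" for u v
    proof -
      have V: "u \<in> verts G" "v \<in> verts G" using uv by (auto dest: adj_in_verts)
      have "distance G w v \<le> Suc (distance G w u)" "distance G w u \<le> Suc (distance G w v)"
        using distance_adj_le connected_reachable[OF con w] V uv adj_commute by blast+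
      with no[OF uv] have "distance G w v = Suc (distance G w u) \<or> distance G w u = Suc (distance G w v)"
        by linarith
      then show ?thesis using V by auto
    qed
    then have "bipartite G" unfolding bipartite_def
      by (intro exI[of _ ?X] exI[of _ ?Y]) blast
    with nb show False by blast
  qed
  then show ?thesis using that by blast
qed

text \<open>A bound for each single vertex; summing it over all vertices later produces the factor
  \<open>n\<close>.\<close>

lemma energy_ge_nonbipartite:
  assumes con: "connected G" and nb: "\<not> bipartite G" and w: "w \<in> verts G"
  shows "2 * (x w)\<^sup>2 \<le> (real (diameter G) + 1) * energy x"
proof -
  have e0: "energy x \<ge> 0" unfolding energy_def by (intro sum_nonneg) auto
  \<comment> \<open>By \<open>sg\<close> the subtracted end term does not share the sign of
    \<open>x w\<close>, so the difference is at least as large as \<open>x w\<close> in absolute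
    value. The bound on \<open>k\<close> leaves room for a geodesic and one more edge.\<close>
  have main: "2 * (x w)\<^sup>2 \<le> (real (diameter G) + 1) * energy x"
    if p: "inj_on p {..k}" "\<And>j. j < k \<Longrightarrow> p j \<rightarrow> p (Suc j)" "p 0 = w"
      and k: "k \<le> Suc (diameter G)" and sg: "x w * ((-1) ^ k * x (p k)) \<le> 0" for p k
  proof -
    have "a\<^sup>2 \<le> (a - b)\<^sup>2" if "a * b \<le> 0" for a b :: real
      using that zero_le_power2[of b] unfolding power2_diff mult.assoc by linarith
    from this[OF sg] have "2 * (x w)\<^sup>2 \<le> 2 * (x w - (-1) ^ k * x (p k))\<^sup>2" by simp
    also have "\<dots> \<le> real k * energy x" using path_energy[OF p(1,2)] p(3) by simp
    also have "\<dots> \<le> (real (diameter G) + 1) * energy x"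
      using k e0 by (intro mult_right_mono) auto
    finally show ?thesis .
  qed
  obtain u v where uv: "u \<rightarrow> v" and lvl: "distance G w u = distance G w v"
    using nonbipartite_level_edge[OF assms] .
  define d where "d = distance G w u"
  have V: "u \<in> verts G" "v \<in> verts G" using uv by (auto dest: adj_in_verts)
  have d: "d \<le> diameter G" unfolding d_def by (rule distance_le_diameter[OF w V(1)])
  show ?thesis
  \<comment> \<open>Both candidate paths end in \<open>v\<close>, one of length \<open>d\<close> and
    one, through \<open>u\<close>, of length \<open>Suc d\<close>. The opposite parities guarantee
    that one of them has the required sign.\<close>
  proof (cases "x w * ((-1) ^ d * x v) \<le> 0")
    case True
    obtain p where p: "p 0 = w" "p d = v" "\<And>j. j < d \<Longrightarrow> p j \<rightarrow> p (Suc j)"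
      "\<And>j. j \<le> d \<Longrightarrow> distance G w (p j) = j"
      using geodesic[OF connected_reachable[OF con w V(2)]] lvl d_def by metis
    have "inj_on p {..d}" using p(4) by (metis atMost_iff inj_onI)
    then show ?thesis by (intro main[of p d]) (use p d True in auto)
  next
    case False
    obtain p where p: "p 0 = w" "p d = u" "\<And>j. j < d \<Longrightarrow> p j \<rightarrow> p (Suc j)"
      "\<And>j. j \<le> d \<Longrightarrow> distance G w (p j) = j"
      using geodesic[OF connected_reachable[OF con w V(1)]] d_def by metis
    have injp: "inj_on p {..d}" using p(4) by (metis atMost_iff inj_onI)
    have "u \<noteq> v" using uv adj_not_same by blast
    \<comment> \<open>As \<open>v\<close> is at distance \<open>d\<close>, it could only be
      \<open>p d\<close>, which is \<open>u\<close>.\<close>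
    have vp: "v \<noteq> p j" if "j \<le> d" for j
      using p(2) p(4)[OF that] lvl \<open>u \<noteq> v\<close> by (auto simp: d_def)
    let ?q = "p(Suc d := v)"
    have "inj_on ?q {..Suc d}"
      using injp vp by (force simp: inj_on_def le_Suc_eq)
    moreover have "?q j \<rightarrow> ?q (Suc j)" if "j < Suc d" for j
      using p(2,3) uv that by (auto simp: less_Suc_eq)
    ultimately show ?thesis
      by (intro main[of ?q "Suc d"]) (use p d False in auto)
  qed
qed

lemma energy_expand:
  "energy x = 2 * (\<Sum>u\<in>verts G. real (out_degree G u) * (x u)\<^sup>2)
    + 2 * (\<Sum>u\<in>verts G. \<Sum>v\<in>verts G. if u \<rightarrow> v then x u * x v else 0)"
proof -
  let ?V = "verts G"
  have dbl: "(\<Sum>(u, v)\<in>arcs_ends G. f u v) = (\<Sum>u\<in>?V. \<Sum>v\<in>?V. if u \<rightarrow> v then f u v else 0)"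
    for f :: "'a \<Rightarrow> 'a \<Rightarrow> real"
    unfolding sum.cartesian_product
    by (rule sum.mono_neutral_cong_left) (auto dest: adj_in_verts)
  have deg: "(\<Sum>v\<in>?V. if u \<rightarrow> v then (x u)\<^sup>2 else 0) = real (out_degree G u) * (x u)\<^sup>2" for u
    by (simp add: out_degree_eq_card flip: sum.inter_filter)
  have fst: "(\<Sum>u\<in>?V. \<Sum>v\<in>?V. if u \<rightarrow> v then (x u)\<^sup>2 else 0)
      = (\<Sum>u\<in>?V. real (out_degree G u) * (x u)\<^sup>2)"
    by (simp add: deg)
  have snd: "(\<Sum>u\<in>?V. \<Sum>v\<in>?V. if u \<rightarrow> v then (x v)\<^sup>2 else 0)
      = (\<Sum>u\<in>?V. real (out_degree G u) * (x u)\<^sup>2)"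
    \<comment> \<open>Swapping the sums and using symmetry of adjacency moves the square to the
      other endpoint.\<close>
    by (subst sum.swap) (use fst in \<open>simp add: adj_commute\<close>)
  have "energy x = (\<Sum>u\<in>?V. \<Sum>v\<in>?V. (if u \<rightarrow> v then (x u)\<^sup>2 else 0)
      + (if u \<rightarrow> v then (x v)\<^sup>2 else 0) + 2 * (if u \<rightarrow> v then x u * x v else 0))"
    unfolding energy_def dbl by (intro sum.cong refl) (auto simp: power2_sum)
  then show ?thesis
    by (simp add: sum.distrib fst snd sum_distrib_left)
qed

text \<open>With the abbreviations of the proof, the energy bound and
  \<open>Q \<le> \<Delta> * S\<close> give \<open>R \<ge> (c - \<Delta>) * S\<close>. Weighting by
  \<open>1 - \<alpha>\<close> and adding the non-negative \<open>\<alpha> * Q\<close> leaves only a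
  comparison of constants.\<close>

lemma quadratic_form_bound:
  assumes con: "connected G" and nb: "\<not> bipartite G"
    and \<alpha>: "0 \<le> \<alpha>" "\<alpha> \<le> 1"
  shows "(- real (max_degree G) + (1 + \<alpha>) / (real (card (verts G)) * (real (diameter G) + 1)))
      * (\<Sum>u\<in>verts G. (x u)\<^sup>2)
    \<le> \<alpha> * (\<Sum>u\<in>verts G. real (out_degree G u) * (x u)\<^sup>2)
      + (1 - \<alpha>) * (\<Sum>u\<in>verts G. \<Sum>v\<in>verts G. if u \<rightarrow> v then x u * x v else 0)"
proof -
  define n D \<Delta> where "n = real (card (verts G))" and "D = real (diameter G) + 1"
    and "\<Delta> = real (max_degree G)"
  define S where "S = (\<Sum>u\<in>verts G. (x u)\<^sup>2)"
  define Q where "Q = (\<Sum>u\<in>verts G. real (out_degree G u) * (x u)\<^sup>2)"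
  define R where "R = (\<Sum>u\<in>verts G. \<Sum>v\<in>verts G. if u \<rightarrow> v then x u * x v else 0)"
  define c where "c = 1 / (n * D)"
  have E: "energy x = 2 * Q + 2 * R" unfolding Q_def R_def by (rule energy_expand)
  have "verts G \<noteq> {}" using con by (auto simp: connected_def strongly_connected_def)
  then obtain w0 where w0: "w0 \<in> verts G" by blast
  obtain a b where ab: "a \<rightarrow> b" using nonbipartite_level_edge[OF con nb w0] .
  have V: "a \<in> verts G" "b \<in> verts G" "a \<noteq> b"
    using ab adj_not_same by (auto dest: adj_in_verts)
  \<comment> \<open>An edge forces two vertices and a positive degree, so
    \<open>2 * c \<le> 1 \<le> \<Delta>\<close>.\<close>
  have n2: "n \<ge> 2"
    using card_mono[of "verts G" "{a, b}"] V by (simp add: n_def)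
  have D1: "D \<ge> 1" by (simp add: D_def)
  have "b \<in> {v \<in> verts G. a \<rightarrow> v}" using ab V by simp
  then have "out_degree G a \<ge> 1"
    by (metis (no_types, lifting) One_nat_def Suc_leI card_gt_0_iff empty_iff finite_Collect_conjI
        finite_verts mem_Collect_eq out_degree_eq_card finite_subset subsetI)
  then have \<Delta>1: "\<Delta> \<ge> 1"
    using out_degree_le_max_degree[OF V(1)] by (simp add: \<Delta>_def)
  have nD: "n * D \<ge> 2" using mult_mono[OF n2 D1] n2 by simp
  have c: "c \<le> 1 / 2" unfolding c_def using nD by (intro divide_left_mono) auto
  have S0: "S \<ge> 0" unfolding S_def by (intro sum_nonneg) auto
  have Q0: "Q \<ge> 0" unfolding Q_def by (intro sum_nonneg) auto
  have Q\<Delta>: "Q \<le> \<Delta> * S"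
    unfolding Q_def S_def sum_distrib_left \<Delta>_def
    by (intro sum_mono mult_right_mono) (auto simp: out_degree_le_max_degree)
  have "2 * S = (\<Sum>w\<in>verts G. 2 * (x w)\<^sup>2)" by (simp add: S_def sum_distrib_left)
  also have "\<dots> \<le> (\<Sum>w\<in>verts G. D * energy x)"
    unfolding D_def by (intro sum_mono energy_ge_nonbipartite[OF con nb])
  also have "\<dots> = 2 * ((n * D) * (Q + R))" by (simp add: n_def E)
  finally have "S \<le> (n * D) * (Q + R)" by linarith
  then have cS: "c * S \<le> Q + R"
    unfolding c_def using nD by (simp add: pos_divide_le_eq mult.commute)
  \<comment> \<open>The constants differ by exactly this term: \<open>- \<Delta> + (1 + \<alpha>) *
    c = (1 - \<alpha>) * (c - \<Delta>) - \<alpha> * (\<Delta> - 2 * c)\<close>.\<close>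
  have "0 \<le> \<alpha> * ((\<Delta> - 2 * c) * S)"
    using \<alpha> \<Delta>1 c S0 by (intro mult_nonneg_nonneg) auto
  then have "(- \<Delta> + (1 + \<alpha>) * c) * S \<le> (1 - \<alpha>) * (c * S - \<Delta> * S)"
    by (simp add: algebra_simps)
  also have "\<dots> \<le> (1 - \<alpha>) * R"
    using \<alpha> cS Q\<Delta> by (intro mult_left_mono) auto
  also have "\<dots> \<le> \<alpha> * Q + (1 - \<alpha>) * R" using \<alpha> Q0 by simp
  finally show ?thesis
    by (simp add: c_def n_def D_def \<Delta>_def S_def Q_def R_def)
qed

end

section \<open>From the matrix to the quadratic form\<close>

lemma A_alpha_carrier: "A_alpha \<alpha> G vs \<in> carrier_mat (length vs) (length vs)"
  by (simp add: A_alpha_def degree_matrix_def adjacency_matrix_def)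

lemma A_alpha_index:
  assumes "i < length vs" "j < length vs"
  shows "A_alpha \<alpha> G vs $$ (i, j) = (if i = j then \<alpha> * real (out_degree G (vs ! i)) else 0)
    + (1 - \<alpha>) * (if vs ! i \<rightarrow>\<^bsub>G\<^esub> vs ! j then 1 else 0)"
  using assms by (simp add: A_alpha_def degree_matrix_def adjacency_matrix_def)

theorem theorem3p7:
  fixes G :: "('a, 'b) pre_digraph" and vs :: "'a list" and n :: nat and \<alpha> :: real
  assumes "graph G" and "connected G" and "card (verts G) = n"
    and "distinct vs" and "set vs = verts G"
    and "0 \<le> \<alpha>" and "\<alpha> \<le> 1"
    and "\<not> bipartite G"
  shows "kth_eigenvalue n (A_alpha \<alpha> G vs)
    \<ge> - real (max_degree G) + (1 + \<alpha>) / (real n * (real (diameter G) + 1))"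
proof -
  interpret graph G by fact
  let ?A = "A_alpha \<alpha> G vs" and ?V = "verts G"
  have n: "length vs = n" using assms(3-5) distinct_card by metis
  have A: "?A \<in> carrier_mat n n" using A_alpha_carrier n by metis
  have sym: "?A $$ (i, j) = ?A $$ (j, i)" if "i < n" "j < n" for i j
    using that n adj_commute by (simp add: A_alpha_index)
  have "?V \<noteq> {}" using assms(2) by (auto simp: connected_def strongly_connected_def)
  then have "1 \<le> n" using assms(3) by (simp add: Suc_le_eq card_gt_0_iff flip: assms(3))
  define ev where "ev = kth_eigenvalue n ?A"
  have "eigenvalue ?A ev" unfolding ev_def
    by (rule kth_eigenvalue_symmetric[OF A sym]) (use \<open>1 \<le> n\<close> in auto)
  then obtain z where z: "z \<in> carrier_vec n" "z \<noteq> 0\<^sub>v n" and eq: "?A *\<^sub>v z = ev \<cdot>\<^sub>v z"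
    using A unfolding eigenvalue_def eigenvector_def by auto
  have bij: "bij_betw ((!) vs) {..<n} ?V"
    using bij_betw_nth[OF assms(4)] n assms(5) by simp
  \<comment> \<open>The eigenvector \<open>z\<close> is indexed by positions in \<open>vs\<close>;
    \<open>x\<close> is the same vector indexed by vertices. Its values outside
    \<open>verts G\<close> do not enter the sums.\<close>
  define x where "x u = z $ inv_into {..<n} ((!) vs) u" for u
  have x: "x (vs ! i) = z $ i" if "i < n" for i
    using that bij by (simp add: x_def bij_betw_def inv_into_f_f)
  have reindex: "(\<Sum>u\<in>?V. f u) = (\<Sum>i<n. f (vs ! i))" for f :: "'a \<Rightarrow> real"
    by (rule sum.reindex_bij_betw[OF bij, symmetric])
  have row: "\<alpha> * real (out_degree G (vs ! i)) * z $ i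
      + (1 - \<alpha>) * (\<Sum>j<n. if vs ! i \<rightarrow>\<^bsub>G\<^esub> vs ! j then z $ j else 0) = ev * z $ i" if "i < n" for i
  proof -
    have "(?A *\<^sub>v z) $ i = (\<Sum>j<n. ?A $$ (i, j) * z $ j)"
      using that A z by (auto simp: mult_mat_vec_def scalar_prod_def lessThan_atLeast0 intro!: sum.cong)
    also have "\<dots> = (\<Sum>j<n. (if i = j then \<alpha> * real (out_degree G (vs ! i)) * z $ j else 0)
        + (1 - \<alpha>) * (if vs ! i \<rightarrow>\<^bsub>G\<^esub> vs ! j then z $ j else 0))"
      using that n by (intro sum.cong) (auto simp: A_alpha_index algebra_simps)
    also have "\<dots> = \<alpha> * real (out_degree G (vs ! i)) * z $ i
      + (1 - \<alpha>) * (\<Sum>j<n. if vs ! i \<rightarrow>\<^bsub>G\<^esub> vs ! j then z $ j else 0)"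
      using that by (simp add: sum.distrib sum_distrib_left)
    finally show ?thesis using eq that z by simp
  qed
  define S where "S = (\<Sum>u\<in>?V. (x u)\<^sup>2)"
  have S: "S = (\<Sum>i<n. (z $ i)\<^sup>2)" unfolding S_def reindex by (intro sum.cong) (auto simp: x)
  \<comment> \<open>Rayleigh quotient: multiplying row \<open>i\<close> of the eigenvalue equation
    by \<open>z $ i\<close> and summing expresses \<open>ev * S\<close> as the quadratic form
    bounded above. Division by \<open>S > 0\<close> then finishes the proof.\<close>
  have "ev * S = (\<Sum>i<n. z $ i * (ev * z $ i))"
    by (simp add: S sum_distrib_left power2_eq_square mult_ac)
  also have "\<dots> = (\<Sum>i<n. \<alpha> * (real (out_degree G (vs ! i)) * (z $ i)\<^sup>2)
      + (1 - \<alpha>) * (\<Sum>j<n. if vs ! i \<rightarrow>\<^bsub>G\<^esub> vs ! j then z $ i * z $ j else 0))"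
  proof (intro sum.cong refl)
    fix i assume "i \<in> {..<n}"
    then have "z $ i * (ev * z $ i) = z $ i * (\<alpha> * real (out_degree G (vs ! i)) * z $ i
      + (1 - \<alpha>) * (\<Sum>j<n. if vs ! i \<rightarrow>\<^bsub>G\<^esub> vs ! j then z $ j else 0))" by (simp add: row)
    also have "\<dots> = \<alpha> * (real (out_degree G (vs ! i)) * (z $ i)\<^sup>2)
      + (1 - \<alpha>) * (z $ i * (\<Sum>j<n. if vs ! i \<rightarrow>\<^bsub>G\<^esub> vs ! j then z $ j else 0))"
      by (simp add: algebra_simps power2_eq_square)
    also have "z $ i * (\<Sum>j<n. if vs ! i \<rightarrow>\<^bsub>G\<^esub> vs ! j then z $ j else 0)
        = (\<Sum>j<n. if vs ! i \<rightarrow>\<^bsub>G\<^esub> vs ! j then z $ i * z $ j else 0)"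
      unfolding sum_distrib_left by (intro sum.cong) auto
    finally show "z $ i * (ev * z $ i) = \<alpha> * (real (out_degree G (vs ! i)) * (z $ i)\<^sup>2)
      + (1 - \<alpha>) * (\<Sum>j<n. if vs ! i \<rightarrow>\<^bsub>G\<^esub> vs ! j then z $ i * z $ j else 0)" .
  qed
  also have "\<dots> = \<alpha> * (\<Sum>u\<in>?V. real (out_degree G u) * (x u)\<^sup>2)
      + (1 - \<alpha>) * (\<Sum>u\<in>?V. \<Sum>v\<in>?V. if u \<rightarrow>\<^bsub>G\<^esub> v then x u * x v else 0)"
    unfolding reindex sum.distrib sum_distrib_left by (simp add: x cong: if_cong)
  finally have "(- real (max_degree G) + (1 + \<alpha>) / (real n * (real (diameter G) + 1))) * S \<le> ev * S"
    using quadratic_form_bound[OF assms(2,8,6,7), of x] assms(3) by (simp add: S_def)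
  moreover have "S > 0"
  proof -
    obtain i where "i < n" "z $ i \<noteq> 0"
      using z by (metis carrier_vecD eq_vecI index_zero_vec)
    then show ?thesis unfolding S by (intro sum_pos2[of _ i]) auto
  qed
  ultimately show ?thesis by (simp add: ev_def)
qed

end
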